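(* Let $\mathfrak{A}$ be a C*-inductive partial *-algebra with the multiplication defined by a family $\{w_\alpha\}$ and with pre-unit $u$. Let $\mathcal{P}(\mathfrak{A})$ denote the set of all positive linear functionals on $\mathfrak{A}$ and $R\mathfrak{A}$ the set of universal right multipliers of $\mathfrak{A}$. Assume, moreover, that the following condition holds: if $y\in\mathfrak{A}$ and $\omega(a^*ya)\ge0$ for all $\omega\in\mathcal{P}(\mathfrak{A})$ and all $a\in R\mathfrak{A}$, then $y\in\mathfrak{A}^+$. Then, for $x\in\mathfrak{A}$, the following conditions are equivalent. (i) $x$ is order bounded with respect to $u$. (ii) There exists $\gamma_x>0$ such that $|\omega(a^*xa)|\le\gamma_x\,\omega(a^*ua)$ for all $\omega\in\mathcal{P}(\mathfrak{A})$ and all $a\in R\mathfrak{A}$. (iii) There exists $\gamma_x>0$ such that $|\omega(b^*xa)|^2\le\gamma_x\,\omega(a^*ua)\,\omega(b^*ub)$ for all $\omega\in\mathcal{P}(\mathfrak{A})$ and all $a,b\in R\mathfrak{A}$.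
   Context: C*-inductive locally convex space: a complex vector space $\mathfrak{A}$ together with an upward directed index set $\mathbb{F}$ and, for each $\alpha\in\mathbb{F}$, a C*-algebra $\mathfrak{B}_\alpha$ (with unit $e_\alpha$, norm $\|\cdot\|_\alpha$, positive cone $\mathfrak{B}_\alpha^+$) and a linear injective map $\phi_\alpha:\mathfrak{B}_\alpha\to\mathfrak{A}$, such that, with $\mathfrak{A}_\alpha:=\phi_\alpha(\mathfrak{B}_\alpha)$ (a Banach space with the norm transported by $\phi_\alpha$): (1) $\mathfrak{A}_\alpha\subseteq\mathfrak{A}_\beta$ if $\alpha\le\beta$; (2) $\mathfrak{A}=\bigcup_\alpha\mathfrak{A}_\alpha$; (3) for $\alpha\le\beta$ the map $j_{\beta\alpha}:=\phi_\beta^{-1}\phi_\alpha:\mathfrak{B}_\alpha\to\mathfrak{B}_\beta$ maps $\mathfrak{B}_\alpha^+$ into $\mathfrak{B}_\beta^+$; (4) $j_{\beta\alpha}(x_\alpha)^*j_{\beta\alpha}(x_\alpha)\le j_{\beta\alpha}(x_\alpha^*x_\alpha)$ for all $x_\alpha\in\mathfrak{B}_\alpha$, $\alpha\le\beta$. $\mathfrak{A}$ carries the locally convex inductive topology generated by the family $\{\mathfrak{B}_\alpha,\phi_\alpha\}$ and the involution $\phi_\alpha(x_\alpha)^*:=\phi_\alpha(x_\alpha^* )$ (well defined, since the $j_{\beta\alpha}$ preserve the involution). For $x\in\mathfrak{A}_\alpha$ write $x_\alpha:=\phi_\alpha^{-1}(x)$ (the representative of $x$ in $\mathfrak{B}_\alpha$).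 Positive elements: $x\in\mathfrak{A}^+$ if there is $\gamma\in\mathbb{F}$ such that $x\in\mathfrak{A}_\alpha$ and $x_\alpha\in\mathfrak{B}_\alpha^+$ for all $\alpha\ge\gamma$; $x\le y$ means $y-x\in\mathfrak{A}^+$. A linear functional $\omega$ on $\mathfrak{A}$ is positive if $\omega(x)\ge0$ for every $x\in\mathfrak{A}^+$. C*-inductive partial *-algebra: a C*-inductive locally convex space $\mathfrak{A}$ with a partial multiplication defined by a family $w=\{w_\alpha\}_{\alpha\in\mathbb{F}}$, $w_\alpha\in\mathfrak{B}_\alpha^+$, $j_{\beta\alpha}(w_\alpha)=w_\beta$ for $\beta\ge\alpha$, as follows: $x\cdot y$ is defined iff there is $\gamma\in\mathbb{F}$ (with $x,y\in\mathfrak{A}_\gamma$) such that $\phi_\beta(x_\beta w_\beta y_\beta)=\phi_{\beta'}(x_{\beta'}w_{\beta'}y_{\beta'})$ for all $\beta,\beta'\ge\gamma$, and then $x\cdot y:=\phi_\beta(x_\beta w_\beta y_\beta)$, $\beta\ge\gamma$. This makes $\mathfrak{A}$ an associative partial *-algebra. $R\mathfrak{A}$ is the set of $a\in\mathfrak{A}$ such that $y\cdot a$ is defined for every $y\in\mathfrak{A}$; if $a\in R\mathfrak{A}$, then $a^*\cdot y$ is defined for every $y\in\mathfrak{A}$. For $a,b\in R\mathfrak{A}$, $b^*ya:=b^*\cdot(y\cdot a)=(b^*\cdot y)\cdot a$. Pre-unit: an element $u=u^*\in\mathfrak{A}$ that belongs to $\mathfrak{A}_\alpha$ with $\|u_\alpha\|_\alpha\le1$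 for every $\alpha\in\mathbb{F}$, and for which there is $\gamma\in\mathbb{F}$ with $u_\beta=j_{\beta\gamma}(e_\gamma)$ for all $\beta\ge\gamma$. Order bounded: $x\in\mathfrak{A}$ is order bounded (with respect to $u$) if there is $\lambda>0$ with $-\lambda u\le\Re(x)\le\lambda u$ and $-\lambda u\le\Im(x)\le\lambda u$, where $\Re(x)=\frac{x+x^*}{2}$, $\Im(x)=\frac{x-x^*}{2i}$. *)

theory Defs
  imports
    "HOL-Library.Complex_Order"
    "HOL-Algebra.Module"
    "HOL-Algebra.Algebraic_Closure_Type"
begin

section \<open>Unital C*-algebras\<close>

text \<open>
  The algebras of a family indexed by a directed set have to share one HOL type, so C*-algebras
  are carrier-based structures: HOL-Algebra modules with an involution and a norm. The scalars
  are the complex numbers, viewed as a HOL-Algebra ring via \<open>ring_of_type_algebra\<close>.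
\<close>

record 'b cstar = "(complex, 'b) module" +
  invol :: "'b \<Rightarrow> 'b"
  cnorm :: "'b \<Rightarrow> real"

locale cstar_algebra =
  Ring.ring B + Module.module "ring_of_type_algebra :: complex ring" B
  for B :: "('b, 'm) cstar_scheme" (structure) +
  assumes smult_mult_left:
      "\<lbrakk>x \<in> carrier B; y \<in> carrier B\<rbrakk> \<Longrightarrow> (c \<odot>\<^bsub>B\<^esub> x) \<otimes> y = c \<odot>\<^bsub>B\<^esub> (x \<otimes> y)"
    and smult_mult_right:
      "\<lbrakk>x \<in> carrier B; y \<in> carrier B\<rbrakk> \<Longrightarrow> x \<otimes> (c \<odot>\<^bsub>B\<^esub> y) = c \<odot>\<^bsub>B\<^esub> (x \<otimes> y)"
    and invol_closed: "x \<in> carrier B \<Longrightarrow> invol B x \<in> carrier B"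
    and invol_invol: "x \<in> carrier B \<Longrightarrow> invol B (invol B x) = x"
    and invol_add:
      "\<lbrakk>x \<in> carrier B; y \<in> carrier B\<rbrakk> \<Longrightarrow> invol B (x \<oplus> y) = invol B x \<oplus> invol B y"
    and invol_smult:
      "x \<in> carrier B \<Longrightarrow> invol B (c \<odot>\<^bsub>B\<^esub> x) = cnj c \<odot>\<^bsub>B\<^esub> invol B x"
    and invol_mult:
      "\<lbrakk>x \<in> carrier B; y \<in> carrier B\<rbrakk> \<Longrightarrow> invol B (x \<otimes> y) = invol B y \<otimes> invol B x"
    and cnorm_nonneg: "x \<in> carrier B \<Longrightarrow> 0 \<le> cnorm B x"
    and cnorm_eq_0: "x \<in> carrier B \<Longrightarrow> cnorm B x = 0 \<longleftrightarrow> x = \<zero>"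
    and cnorm_triangle:
      "\<lbrakk>x \<in> carrier B; y \<in> carrier B\<rbrakk> \<Longrightarrow> cnorm B (x \<oplus> y) \<le> cnorm B x + cnorm B y"
    and cnorm_smult: "x \<in> carrier B \<Longrightarrow> cnorm B (c \<odot>\<^bsub>B\<^esub> x) = cmod c * cnorm B x"
    and cnorm_mult:
      "\<lbrakk>x \<in> carrier B; y \<in> carrier B\<rbrakk> \<Longrightarrow> cnorm B (x \<otimes> y) \<le> cnorm B x * cnorm B y"
    and cstar_identity: "x \<in> carrier B \<Longrightarrow> cnorm B (invol B x \<otimes> x) = (cnorm B x)\<^sup>2"
    and complete:
      "\<lbrakk>\<And>n. s n \<in> carrier B;
        \<forall>e>0. \<exists>N. \<forall>m\<ge>N. \<forall>n\<ge>N. cnorm B (s m \<ominus> s n) < e\<rbrakk>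
        \<Longrightarrow> \<exists>l\<in>carrier B. (\<lambda>n. cnorm B (s n \<ominus> l)) \<longlonglongrightarrow> (0::real)"

definition cstar_pos :: "('b, 'm) cstar_scheme \<Rightarrow> 'b set" where
  "cstar_pos B = {invol B y \<otimes>\<^bsub>B\<^esub> y | y. y \<in> carrier B}"

definition cstar_le :: "('b, 'm) cstar_scheme \<Rightarrow> 'b \<Rightarrow> 'b \<Rightarrow> bool" where
  "cstar_le B x y \<longleftrightarrow> y \<ominus>\<^bsub>B\<^esub> x \<in> cstar_pos B"

section \<open>C*-inductive locally convex spaces\<close>

text \<open>
  The vector space is the whole type \<open>'a\<close>, the index set is the whole type \<open>'i\<close>, and \<open>\<phi> \<alpha>\<close>
  is only meaningful on \<open>carrier (B \<alpha>)\<close>.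
\<close>

definition ind_step :: "('i \<Rightarrow> 'b cstar) \<Rightarrow> ('i \<Rightarrow> 'b \<Rightarrow> 'a) \<Rightarrow> 'i \<Rightarrow> 'a set" where
  "ind_step B \<phi> \<alpha> = \<phi> \<alpha> ` carrier (B \<alpha>)"

definition ind_rep :: "('i \<Rightarrow> 'b cstar) \<Rightarrow> ('i \<Rightarrow> 'b \<Rightarrow> 'a) \<Rightarrow> 'i \<Rightarrow> 'a \<Rightarrow> 'b" where
  "ind_rep B \<phi> \<alpha> x = inv_into (carrier (B \<alpha>)) (\<phi> \<alpha>) x"

definition ind_conn :: "('i \<Rightarrow> 'b cstar) \<Rightarrow> ('i \<Rightarrow> 'b \<Rightarrow> 'a) \<Rightarrow> 'i \<Rightarrow> 'i \<Rightarrow> 'b \<Rightarrow> 'b" where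
  "ind_conn B \<phi> \<beta> \<alpha> b = ind_rep B \<phi> \<beta> (\<phi> \<alpha> b)"

text \<open>
  The inductive topology (the finest locally convex topology making all \<open>\<phi> \<alpha>\<close> continuous) is
  determined by the data below, and no notion in this theory refers to it.
\<close>

locale cstar_inductive_space = vector_space scale
  for scale :: "complex \<Rightarrow> 'a::ab_group_add \<Rightarrow> 'a" +
  fixes B :: "'i::preorder \<Rightarrow> 'b cstar"
    and \<phi> :: "'i \<Rightarrow> 'b \<Rightarrow> 'a"
  assumes directed: "\<exists>\<gamma>::'i. \<alpha> \<le> \<gamma> \<and> \<beta> \<le> \<gamma>"
    and cstar: "cstar_algebra (B \<alpha>)"
    and emb_add:
      "\<lbrakk>x \<in> carrier (B \<alpha>); y \<in> carrier (B \<alpha>)\<rbrakk>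
        \<Longrightarrow> \<phi> \<alpha> (x \<oplus>\<^bsub>B \<alpha>\<^esub> y) = \<phi> \<alpha> x + \<phi> \<alpha> y"
    and emb_smult: "x \<in> carrier (B \<alpha>) \<Longrightarrow> \<phi> \<alpha> (c \<odot>\<^bsub>B \<alpha>\<^esub> x) = scale c (\<phi> \<alpha> x)"
    and emb_inj: "inj_on (\<phi> \<alpha>) (carrier (B \<alpha>))"
    and step_mono: "\<alpha> \<le> \<beta> \<Longrightarrow> ind_step B \<phi> \<alpha> \<subseteq> ind_step B \<phi> \<beta>"
    and step_exhaust: "(\<Union>\<alpha>. ind_step B \<phi> \<alpha>) = UNIV"
    and conn_pos:
      "\<lbrakk>\<alpha> \<le> \<beta>; x \<in> cstar_pos (B \<alpha>)\<rbrakk> \<Longrightarrow> ind_conn B \<phi> \<beta> \<alpha> x \<in> cstar_pos (B \<beta>)"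
    and conn_schwarz:
      "\<lbrakk>\<alpha> \<le> \<beta>; x \<in> carrier (B \<alpha>)\<rbrakk>
        \<Longrightarrow> cstar_le (B \<beta>)
              (invol (B \<beta>) (ind_conn B \<phi> \<beta> \<alpha> x) \<otimes>\<^bsub>B \<beta>\<^esub> ind_conn B \<phi> \<beta> \<alpha> x)
              (ind_conn B \<phi> \<beta> \<alpha> (invol (B \<alpha>) x \<otimes>\<^bsub>B \<alpha>\<^esub> x))"

text \<open>
  Independence of \<open>\<alpha>\<close> holds because the connecting maps, being linear and positive, preserve
  the involution.
\<close>

definition ind_star :: "('i \<Rightarrow> 'b cstar) \<Rightarrow> ('i \<Rightarrow> 'b \<Rightarrow> 'a) \<Rightarrow> 'a \<Rightarrow> 'a" where
  "ind_star B \<phi> x =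
    (THE y. \<exists>\<alpha>. x \<in> ind_step B \<phi> \<alpha> \<and> y = \<phi> \<alpha> (invol (B \<alpha>) (ind_rep B \<phi> \<alpha> x)))"

definition ind_pos :: "('i::preorder \<Rightarrow> 'b cstar) \<Rightarrow> ('i \<Rightarrow> 'b \<Rightarrow> 'a) \<Rightarrow> 'a set" where
  "ind_pos B \<phi> =
    {x. \<exists>\<gamma>. \<forall>\<alpha>\<ge>\<gamma>. x \<in> ind_step B \<phi> \<alpha> \<and> ind_rep B \<phi> \<alpha> x \<in> cstar_pos (B \<alpha>)}"

definition ind_le ::
  "('i::preorder \<Rightarrow> 'b cstar) \<Rightarrow> ('i \<Rightarrow> 'b \<Rightarrow> 'a::ab_group_add) \<Rightarrow> 'a \<Rightarrow> 'a \<Rightarrow> bool" where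
  "ind_le B \<phi> x y \<longleftrightarrow> y - x \<in> ind_pos B \<phi>"

text \<open>
  In the order of \<open>HOL-Library.Complex_Order\<close>, \<open>0 \<le> \<omega> x\<close> says that \<open>\<omega> x\<close> is real and
  nonnegative.
\<close>

definition pos_functionals ::
  "(complex \<Rightarrow> 'a::ab_group_add \<Rightarrow> 'a) \<Rightarrow> ('i::preorder \<Rightarrow> 'b cstar) \<Rightarrow> ('i \<Rightarrow> 'b \<Rightarrow> 'a)
    \<Rightarrow> ('a \<Rightarrow> complex) set" where
  "pos_functionals scale B \<phi> =
    {\<omega>. Vector_Spaces.linear scale (*) \<omega> \<and> (\<forall>x\<in>ind_pos B \<phi>. 0 \<le> \<omega> x)}"

section \<open>C*-inductive partial *-algebras\<close>

locale cstar_inductive_partial_algebra = cstar_inductive_space scale B \<phi>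
  for scale :: "complex \<Rightarrow> 'a::ab_group_add \<Rightarrow> 'a"
    and B :: "'i::preorder \<Rightarrow> 'b cstar"
    and \<phi> :: "'i \<Rightarrow> 'b \<Rightarrow> 'a" +
  fixes w :: "'i \<Rightarrow> 'b"
  assumes w_pos: "w \<alpha> \<in> cstar_pos (B \<alpha>)"
    and w_conn: "\<alpha> \<le> \<beta> \<Longrightarrow> ind_conn B \<phi> \<beta> \<alpha> (w \<alpha>) = w \<beta>"

definition step_mult ::
  "('i \<Rightarrow> 'b cstar) \<Rightarrow> ('i \<Rightarrow> 'b \<Rightarrow> 'a) \<Rightarrow> ('i \<Rightarrow> 'b) \<Rightarrow> 'i \<Rightarrow> 'a \<Rightarrow> 'a \<Rightarrow> 'a" where
  "step_mult B \<phi> w \<beta> x y =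
    \<phi> \<beta> (ind_rep B \<phi> \<beta> x \<otimes>\<^bsub>B \<beta>\<^esub> w \<beta> \<otimes>\<^bsub>B \<beta>\<^esub> ind_rep B \<phi> \<beta> y)"

definition pmult_defined ::
  "('i::preorder \<Rightarrow> 'b cstar) \<Rightarrow> ('i \<Rightarrow> 'b \<Rightarrow> 'a) \<Rightarrow> ('i \<Rightarrow> 'b) \<Rightarrow> 'a \<Rightarrow> 'a \<Rightarrow> bool" where
  "pmult_defined B \<phi> w x y \<longleftrightarrow>
    (\<exists>\<gamma>. x \<in> ind_step B \<phi> \<gamma> \<and> y \<in> ind_step B \<phi> \<gamma> \<and>
      (\<forall>\<beta>\<ge>\<gamma>. \<forall>\<beta>'\<ge>\<gamma>. step_mult B \<phi> w \<beta> x y = step_mult B \<phi> w \<beta>' x y))"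

text \<open>The value is meaningful only if \<open>pmult_defined B \<phi> w x y\<close>.\<close>

definition pmult ::
  "('i::preorder \<Rightarrow> 'b cstar) \<Rightarrow> ('i \<Rightarrow> 'b \<Rightarrow> 'a) \<Rightarrow> ('i \<Rightarrow> 'b) \<Rightarrow> 'a \<Rightarrow> 'a \<Rightarrow> 'a" where
  "pmult B \<phi> w x y =
    (THE z. \<exists>\<gamma>. x \<in> ind_step B \<phi> \<gamma> \<and> y \<in> ind_step B \<phi> \<gamma> \<and>
      (\<forall>\<beta>\<ge>\<gamma>. z = step_mult B \<phi> w \<beta> x y))"

definition right_mults ::
  "('i::preorder \<Rightarrow> 'b cstar) \<Rightarrow> ('i \<Rightarrow> 'b \<Rightarrow> 'a) \<Rightarrow> ('i \<Rightarrow> 'b) \<Rightarrow> 'a set" where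
  "right_mults B \<phi> w = {a. \<forall>y. pmult_defined B \<phi> w y a}"

text \<open>\<open>sandwich B \<phi> w b y a\<close> is \<open>b\<^sup>* y a\<close>, for \<open>a\<close> and \<open>b\<close> in \<open>right_mults B \<phi> w\<close>.\<close>

definition sandwich ::
  "('i::preorder \<Rightarrow> 'b cstar) \<Rightarrow> ('i \<Rightarrow> 'b \<Rightarrow> 'a) \<Rightarrow> ('i \<Rightarrow> 'b) \<Rightarrow> 'a \<Rightarrow> 'a \<Rightarrow> 'a \<Rightarrow> 'a" where
  "sandwich B \<phi> w b y a = pmult B \<phi> w (ind_star B \<phi> b) (pmult B \<phi> w y a)"

definition pre_unit :: "('i::preorder \<Rightarrow> 'b cstar) \<Rightarrow> ('i \<Rightarrow> 'b \<Rightarrow> 'a) \<Rightarrow> 'a \<Rightarrow> bool" where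
  "pre_unit B \<phi> u \<longleftrightarrow>
    u = ind_star B \<phi> u \<and>
    (\<forall>\<alpha>. u \<in> ind_step B \<phi> \<alpha> \<and> cnorm (B \<alpha>) (ind_rep B \<phi> \<alpha> u) \<le> 1) \<and>
    (\<exists>\<gamma>. \<forall>\<beta>\<ge>\<gamma>. ind_rep B \<phi> \<beta> u = ind_conn B \<phi> \<beta> \<gamma> \<one>\<^bsub>B \<gamma>\<^esub>)"

definition ind_Re ::
  "(complex \<Rightarrow> 'a::ab_group_add \<Rightarrow> 'a) \<Rightarrow> ('i \<Rightarrow> 'b cstar) \<Rightarrow> ('i \<Rightarrow> 'b \<Rightarrow> 'a) \<Rightarrow> 'a \<Rightarrow> 'a"
  where "ind_Re scale B \<phi> x = scale (1 / 2) (x + ind_star B \<phi> x)"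

definition ind_Im ::
  "(complex \<Rightarrow> 'a::ab_group_add \<Rightarrow> 'a) \<Rightarrow> ('i \<Rightarrow> 'b cstar) \<Rightarrow> ('i \<Rightarrow> 'b \<Rightarrow> 'a) \<Rightarrow> 'a \<Rightarrow> 'a"
  where "ind_Im scale B \<phi> x = scale (1 / (2 * \<i>)) (x - ind_star B \<phi> x)"

definition order_bounded ::
  "(complex \<Rightarrow> 'a::ab_group_add \<Rightarrow> 'a) \<Rightarrow> ('i::preorder \<Rightarrow> 'b cstar) \<Rightarrow> ('i \<Rightarrow> 'b \<Rightarrow> 'a)
    \<Rightarrow> 'a \<Rightarrow> 'a \<Rightarrow> bool" where
  "order_bounded scale B \<phi> u x \<longleftrightarrow>
    (\<exists>r::real. 0 < r \<and>
      ind_le B \<phi> (- scale (of_real r) u) (ind_Re scale B \<phi> x) \<and>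
      ind_le B \<phi> (ind_Re scale B \<phi> x) (scale (of_real r) u) \<and>
      ind_le B \<phi> (- scale (of_real r) u) (ind_Im scale B \<phi> x) \<and>
      ind_le B \<phi> (ind_Im scale B \<phi> x) (scale (of_real r) u))"

end

theory Submission
  imports Defs
begin

text \<open>
  For \<open>p \<ge> 0\<close> and a universal right multiplier \<open>a\<close>, the representatives of \<open>a\<^sup>* p a\<close> have
  eventually the form \<open>(z w a)\<^sup>* (z w a)\<close> with \<open>p = z\<^sup>* z\<close>, so \<open>a\<^sup>* p a \<ge> 0\<close> and
  \<open>(a, b) \<mapsto> \<omega> (b\<^sup>* p a)\<close> is a positive sesquilinear form. If \<open>- r u \<le> y \<le> r u\<close>, the Cauchy-Schwarz
  inequalities for \<open>p = r u + y\<close> and \<open>q = r u - y\<close> combine to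
  \<open>\<bar>\<omega> (b\<^sup>* y a)\<bar>\<^sup>2 \<le> r\<^sup>2 \<omega> (a\<^sup>* u a) \<omega> (b\<^sup>* u b)\<close>; with \<open>y\<close> the real and the imaginary part
  of \<open>x\<close> this gives (iii), and \<open>b = a\<close> gives (ii). Conversely, positive functionals are hermitian, so
  (ii) bounds \<open>\<omega> (a\<^sup>* y a)\<close> for \<open>y\<close> the real or the imaginary part of \<open>x\<close>, and the assumption on
  \<open>\<AA>\<^sup>+\<close> turns this into (i). No C*-theory beyond algebra enters: every element is a linear
  combination of elements \<open>y\<^sup>* y\<close>, which also shows that the connecting maps and the positive
  functionals respect the involution.
\<close>

section \<open>Algebra inside a single C*-algebra\<close>

context cstar_algebra
begin

lemma ring_B: "Ring.ring B"
  by intro_locales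

text \<open>
  In this locale the short names of the ring laws (such as \<open>m_assoc\<close>) refer to the scalar ring,
  not to \<open>B\<close>.
\<close>

lemmas mult_assoc = monoid.m_assoc[OF ring.is_monoid[OF ring_B]]
lemmas distribs = ring.ring_simprules(13,23)[OF ring_B]
lemmas add_ac = ring.ring_simprules(7,10,22)[OF ring_B]

lemma invol_one: "invol B \<one> = \<one>"
  using invol_mult[of "invol B \<one>" \<one>] by (simp add: invol_closed invol_invol)

lemma smult_carrier: "x \<in> carrier B \<Longrightarrow> c \<odot>\<^bsub>B\<^esub> x \<in> carrier B"
  by (simp add: smult_closed ring_of_type_algebra_def)

lemma smult_add: "\<lbrakk>x \<in> carrier B; y \<in> carrier B\<rbrakk> \<Longrightarrow>
    c \<odot>\<^bsub>B\<^esub> (x \<oplus> y) = c \<odot>\<^bsub>B\<^esub> x \<oplus> c \<odot>\<^bsub>B\<^esub> y"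
  by (simp add: smult_r_distr ring_of_type_algebra_def)

lemma add_smult: "x \<in> carrier B \<Longrightarrow> (c + d) \<odot>\<^bsub>B\<^esub> x = c \<odot>\<^bsub>B\<^esub> x \<oplus> d \<odot>\<^bsub>B\<^esub> x"
  using smult_l_distr[of c d x] by (simp add: ring_of_type_algebra_def)

lemma smult_smult: "x \<in> carrier B \<Longrightarrow> c \<odot>\<^bsub>B\<^esub> (d \<odot>\<^bsub>B\<^esub> x) = (c * d) \<odot>\<^bsub>B\<^esub> x"
  using smult_assoc1[of c d x] by (simp add: ring_of_type_algebra_def)

lemma one_smult: "x \<in> carrier B \<Longrightarrow> 1 \<odot>\<^bsub>B\<^esub> x = x"
  using smult_one[of x] by (simp add: ring_of_type_algebra_def)

lemma zero_smult: "x \<in> carrier B \<Longrightarrow> 0 \<odot>\<^bsub>B\<^esub> x = \<zero>"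
  using smult_l_null[of x] by (simp add: ring_of_type_algebra_def)

lemma cstar_posD:
  assumes "p \<in> cstar_pos B"
  shows cstar_pos_carrier: "p \<in> carrier B" and invol_pos: "invol B p = p"
  using assms by (auto simp: cstar_pos_def invol_closed invol_mult invol_invol)

lemma one_pos: "\<one> \<in> cstar_pos B"
  unfolding cstar_pos_def using invol_one by (auto intro!: exI[of _ \<one>])

lemma conj_pos:
  assumes "p \<in> cstar_pos B" "v \<in> carrier B"
  shows "invol B v \<otimes> p \<otimes> v \<in> cstar_pos B"
proof -
  obtain z where z: "z \<in> carrier B" "p = invol B z \<otimes> z"
    using assms by (auto simp: cstar_pos_def)
  then have "invol B v \<otimes> p \<otimes> v = invol B (z \<otimes> v) \<otimes> (z \<otimes> v)"
    using assms by (simp add: invol_mult invol_closed mult_assoc)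
  then show ?thesis
    using z assms by (auto simp: cstar_pos_def)
qed

text \<open>Polarisation: if \<open>c * cnj c = 1\<close> and \<open>y = c x + 1\<close>, then
  \<open>y* y\<close> is \<open>c x + cnj c x*\<close> plus a remainder independent of
  \<open>c\<close>, and the values \<open>c = 1\<close> and \<open>c = \<i>\<close> recover
  \<open>x\<close>. Claims that are linear or conjugate-linear in \<open>x\<close> can therefore be
  checked on positive elements.\<close>

lemma pos_span_induct [consumes 1, case_names pos add smult]:
  assumes x: "x \<in> carrier B"
    and pos: "\<And>p. p \<in> cstar_pos B \<Longrightarrow> Q p"
    and add: "\<And>y z. \<lbrakk>y \<in> carrier B; z \<in> carrier B; Q y; Q z\<rbrakk> \<Longrightarrow> Q (y \<oplus> z)"
    and smult: "\<And>c y. \<lbrakk>y \<in> carrier B; Q y\<rbrakk> \<Longrightarrow> Q (c \<odot>\<^bsub>B\<^esub> y)"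
  shows "Q x"
proof -
  let ?x' = "invol B x"
  define s where "s = ?x' \<otimes> x \<oplus> \<one>"
  note cl = x invol_closed smult_carrier
  have "Q (?x' \<otimes> x)"
    using x by (auto intro!: pos simp: cstar_pos_def)
  then have s: "s \<in> carrier B" "Q s"
    unfolding s_def using pos[OF one_pos] by (simp_all add: add cl)
  \<comment> \<open>The remainder \<open>s\<close> is removed by adding its multiple by
    \<open>-1\<close>, because \<open>Q\<close> is closed under sums and scalar multiples.\<close>
  have neg: "Q (y \<oplus> (-1) \<odot>\<^bsub>B\<^esub> s)" if "y \<in> carrier B" "Q y" for y
    using that s by (auto intro!: add smult cl)
  have cancel: "y \<oplus> s \<oplus> (-1) \<odot>\<^bsub>B\<^esub> s = y" if "y \<in> carrier B" for y
    using add_smult[of s 1 "-1"] that s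
    by (simp add: add_ac(1) one_smult zero_smult cl)
  have *: "Q (c \<odot>\<^bsub>B\<^esub> x \<oplus> cnj c \<odot>\<^bsub>B\<^esub> ?x')" if "c * cnj c = 1" for c
  proof -
    let ?y = "c \<odot>\<^bsub>B\<^esub> x \<oplus> \<one>"
    have y: "?y \<in> carrier B"
      by (simp add: cl)
    have "invol B ?y \<otimes> ?y = (cnj c \<odot>\<^bsub>B\<^esub> ?x' \<oplus> \<one>) \<otimes> ?y"
      by (simp add: cl invol_add invol_smult invol_one)
    also have "\<dots> = (c \<odot>\<^bsub>B\<^esub> x \<oplus> cnj c \<odot>\<^bsub>B\<^esub> ?x') \<oplus> s"
      using that
      by (simp add: cl distribs smult_mult_left smult_mult_right smult_smult smult_add one_smult
          add_ac s_def mult.commute)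
    finally have "invol B ?y \<otimes> ?y = (c \<odot>\<^bsub>B\<^esub> x \<oplus> cnj c \<odot>\<^bsub>B\<^esub> ?x') \<oplus> s" .
    moreover have "Q (invol B ?y \<otimes> ?y)"
      using y by (auto intro!: pos simp: cstar_pos_def)
    ultimately show ?thesis
      using neg[of "(c \<odot>\<^bsub>B\<^esub> x \<oplus> cnj c \<odot>\<^bsub>B\<^esub> ?x') \<oplus> s"] cancel s by (simp add: cl)
  qed
  \<comment> \<open>The factor \<open>- \<i>\<close> turns the combination for
    \<open>c = \<i>\<close> into \<open>x - x*\<close>; added to \<open>x + x*\<close> it leaves
    \<open>2 x\<close>.\<close>
  have "(1 / 2) \<odot>\<^bsub>B\<^esub> ((1 \<odot>\<^bsub>B\<^esub> x \<oplus> cnj 1 \<odot>\<^bsub>B\<^esub> ?x') \<oplus>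
      (- \<i>) \<odot>\<^bsub>B\<^esub> (\<i> \<odot>\<^bsub>B\<^esub> x \<oplus> cnj \<i> \<odot>\<^bsub>B\<^esub> ?x'))
    = ((1 / 2) \<odot>\<^bsub>B\<^esub> x \<oplus> (1 / 2) \<odot>\<^bsub>B\<^esub> x) \<oplus> ((1 / 2) \<odot>\<^bsub>B\<^esub> ?x' \<oplus> (- 1 / 2) \<odot>\<^bsub>B\<^esub> ?x')"
    by (simp add: cl smult_add smult_smult add_ac)
  also have "\<dots> = x"
    using add_smult[of x "1/2" "1/2"] add_smult[of ?x' "1/2" "-1/2"]
    by (simp add: cl one_smult zero_smult)
  finally have "x = (1 / 2) \<odot>\<^bsub>B\<^esub> ((1 \<odot>\<^bsub>B\<^esub> x \<oplus> cnj 1 \<odot>\<^bsub>B\<^esub> ?x') \<oplus>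
      (- \<i>) \<odot>\<^bsub>B\<^esub> (\<i> \<odot>\<^bsub>B\<^esub> x \<oplus> cnj \<i> \<odot>\<^bsub>B\<^esub> ?x'))" ..
  moreover have "Q \<dots>"
    by (intro add smult *) (simp_all add: cl)
  ultimately show ?thesis
    by simp
qed

end

section \<open>Scalar inequalities behind Cauchy-Schwarz\<close>

text \<open>After expansion only the cross term \<open>2 m n \<le> a d + c b\<close> is left, and it
  follows from \<open>m\<^sup>2 n\<^sup>2 \<le> (a d) (c b)\<close> by the arithmetic-geometric mean
  inequality. This is how two Cauchy-Schwarz estimates are added.\<close>

lemma square_sum_le_product:
  fixes m n a b c d :: real
  assumes "m\<^sup>2 \<le> a * b" "n\<^sup>2 \<le> c * d" "0 \<le> a" "0 \<le> b" "0 \<le> c" "0 \<le> d"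
  shows "(m + n)\<^sup>2 \<le> (a + c) * (b + d)"
proof -
  have "(m * n)\<^sup>2 \<le> (a * b) * (c * d)"
    unfolding power_mult_distrib using assms by (intro mult_mono) auto
  moreover have "(a * d + c * b)\<^sup>2 - 4 * ((a * b) * (c * d)) = (a * d - c * b)\<^sup>2"
    by (simp add: power2_eq_square algebra_simps)
  moreover have "(2 * (m * n))\<^sup>2 = 4 * (m * n)\<^sup>2"
    by (simp add: power_mult_distrib)
  ultimately have "(2 * (m * n))\<^sup>2 \<le> (a * d + c * b)\<^sup>2"
    using zero_le_power2[of "a * d - c * b"] by linarith
  then have "2 * (m * n) \<le> a * d + c * b"
    by (rule power2_le_imp_le) (simp add: assms(3-6))
  then show ?thesis
    using assms(1,2) by (simp add: power2_sum distrib_left distrib_right)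
qed

text \<open>Cauchy-Schwarz in terms of coefficients: \<open>A\<close>, \<open>D\<close>,
  \<open>E\<close>, \<open>C\<close> stand for the values of a form at \<open>(a, a)\<close>,
  \<open>(a, b)\<close>, \<open>(b, a)\<close>, \<open>(b, b)\<close>, and \<open>nonneg\<close> is
  its positivity at \<open>a + c b\<close>.\<close>

lemma sesquilinear_discriminant:
  fixes A C D E :: complex
  assumes nonneg: "\<And>c. 0 \<le> A + c * D + cnj c * E + c * cnj c * C"
    and C: "0 \<le> C"
  shows "(cmod E)\<^sup>2 \<le> Re A * Re C"
proof -
  \<comment> \<open>Nonnegativity in the complex order includes being real; the imaginary parts at
    \<open>c = 1\<close> and \<open>c = \<i>\<close> make the form hermitian.\<close>
  have "Im E = - Im D" "Re E = Re D"
    using nonneg[of 0] nonneg[of 1] nonneg[of "\<i>"] C by (auto simp: less_eq_complex_def)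
  then have D: "D = cnj E"
    by (simp add: complex_eq_iff)
  define e where "e = (cmod E)\<^sup>2"
  \<comment> \<open>This is \<open>nonneg\<close> at \<open>c = - s E\<close>, whose phase makes
    both cross terms equal to \<open>- s e\<close>.\<close>
  have *: "0 \<le> Re A - 2 * s * e + s\<^sup>2 * e * Re C" for s :: real
  proof -
    have EE: "E * cnj E = of_real e"
      by (simp add: e_def complex_norm_square flip: of_real_power)
    have "A + (- of_real s * E) * D + cnj (- of_real s * E) * E
        + (- of_real s * E) * cnj (- of_real s * E) * C
      = A - 2 * of_real s * (E * cnj E) + (of_real s)\<^sup>2 * (E * cnj E) * C"
      by (simp add: D algebra_simps power2_eq_square)
    also have "\<dots> = A - of_real (2 * s * e) + of_real (s\<^sup>2 * e) * C"
      unfolding EE by simp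
    finally have "0 \<le> A - of_real (2 * s * e) + of_real (s\<^sup>2 * e) * C"
      using nonneg[of "- of_real s * E"] by argo
    then show ?thesis
      by (simp only: less_eq_complex_def) simp
  qed
  have "0 \<le> Re A" "0 \<le> Re C"
    using nonneg[of 0] C by (auto simp: less_eq_complex_def)
  have "e \<le> Re A * Re C"
  proof (cases "Re C = 0")
    case True
    have "e = 0"
    proof (rule ccontr)
      \<comment> \<open>For \<open>Re C = 0\<close> the expression in \<open>*\<close> is affine in
        \<open>s\<close>; the chosen \<open>s\<close> gives it the value \<open>-1\<close>.\<close>
      assume "e \<noteq> 0"
      then show False
        using *[of "(Re A + 1) / (2 * e)"] True by simp
    qed
    then show ?thesis
      using True by simp
  next
    case False
    \<comment> \<open>The quadratic in \<open>s\<close> has its minimum at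
      \<open>s = 1 / Re C\<close> when \<open>e > 0\<close>.\<close>
    then show ?thesis
      using *[of "1 / Re C"] \<open>0 \<le> Re C\<close> by (simp add: field_simps power2_eq_square)
  qed
  then show ?thesis
    by (simp add: e_def)
qed


section \<open>Triple products with a self-adjoint weight in a single C*-algebra\<close>

context cstar_algebra
begin

text \<open>\<open>T\<close> has the shape and bracketing of the representatives of
  \<open>b* p a\<close>, with \<open>v\<close> in the role of the weight. The expansion supplies the
  four coefficients for \<open>sesquilinear_discriminant\<close>.\<close>

lemma triple_diagonal:
  assumes "a \<in> carrier B" "b \<in> carrier B" "p \<in> carrier B" "v \<in> carrier B"
  defines "T \<equiv> \<lambda>s t. invol B s \<otimes> v \<otimes> (p \<otimes> v \<otimes> t)"
  shows "T (a \<oplus> c \<odot>\<^bsub>B\<^esub> b) (a \<oplus> c \<odot>\<^bsub>B\<^esub> b) =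
    T a a \<oplus> c \<odot>\<^bsub>B\<^esub> T a b \<oplus> cnj c \<odot>\<^bsub>B\<^esub> T b a \<oplus> (c * cnj c) \<odot>\<^bsub>B\<^esub> T b b"
  using assms(1-4)
  by (simp add: T_def invol_add invol_smult invol_closed smult_carrier distribs
      smult_mult_left smult_mult_right smult_smult smult_add add_ac mult.commute)

lemma triple_middle:
  assumes "a \<in> carrier B" "b \<in> carrier B" "p \<in> carrier B" "q \<in> carrier B" "v \<in> carrier B"
  defines "T \<equiv> \<lambda>p. invol B b \<otimes> v \<otimes> (p \<otimes> v \<otimes> a)"
  shows "T (p \<oplus> c \<odot>\<^bsub>B\<^esub> q) = T p \<oplus> c \<odot>\<^bsub>B\<^esub> T q"
  using assms(1-5)
  by (simp add: T_def invol_closed smult_carrier distribs smult_mult_left smult_mult_right)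

lemma triple_invol:
  assumes "a \<in> carrier B" "b \<in> carrier B" "p \<in> carrier B" "v \<in> carrier B" "invol B v = v"
  shows "invol B (invol B b \<otimes> v \<otimes> (p \<otimes> v \<otimes> a)) = invol B a \<otimes> v \<otimes> (invol B p \<otimes> v \<otimes> b)"
  using assms by (simp add: invol_mult invol_invol invol_closed mult_assoc)

text \<open>As \<open>v\<close> is self-adjoint, the product is \<open>p\<close> conjugated by
  \<open>v a\<close>, which \<open>conj_pos\<close> covers.\<close>

lemma triple_pos:
  assumes "a \<in> carrier B" "p \<in> cstar_pos B" "v \<in> carrier B" "invol B v = v"
  shows "invol B a \<otimes> v \<otimes> (p \<otimes> v \<otimes> a) \<in> cstar_pos B"
proof -
  have "invol B (v \<otimes> a) \<otimes> p \<otimes> (v \<otimes> a) = invol B a \<otimes> v \<otimes> (p \<otimes> v \<otimes> a)"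
    using assms cstar_pos_carrier by (simp add: invol_mult invol_closed mult_assoc)
  then show ?thesis
    using conj_pos[of p "v \<otimes> a"] assms by simp
qed

end

section \<open>Representatives, involution and positive functionals on the inductive space\<close>

context cstar_inductive_space
begin

interpretation C: cstar_algebra "B \<alpha>" for \<alpha>
  by (rule cstar)

abbreviation "step \<equiv> ind_step B \<phi>"
abbreviation "rep \<equiv> ind_rep B \<phi>"
abbreviation "star \<equiv> ind_star B \<phi>"

lemma emb_step: "b \<in> carrier (B \<alpha>) \<Longrightarrow> \<phi> \<alpha> b \<in> step \<alpha>"
  by (simp add: ind_step_def)

lemma rep_emb: "b \<in> carrier (B \<alpha>) \<Longrightarrow> rep \<alpha> (\<phi> \<alpha> b) = b"
  by (simp add: ind_rep_def inv_into_f_f emb_inj)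

lemma rep_carrier: "x \<in> step \<alpha> \<Longrightarrow> rep \<alpha> x \<in> carrier (B \<alpha>)"
  by (simp add: ind_rep_def ind_step_def inv_into_into)

lemma emb_rep: "x \<in> step \<alpha> \<Longrightarrow> \<phi> \<alpha> (rep \<alpha> x) = x"
  by (simp add: ind_rep_def ind_step_def f_inv_into_f)

lemma rep_add_scale:
  assumes "x \<in> step \<alpha>" "y \<in> step \<alpha>"
  shows "rep \<alpha> (x + scale c y) = rep \<alpha> x \<oplus>\<^bsub>B \<alpha>\<^esub> c \<odot>\<^bsub>B \<alpha>\<^esub> rep \<alpha> y"
proof -
  let ?b = "rep \<alpha> x \<oplus>\<^bsub>B \<alpha>\<^esub> c \<odot>\<^bsub>B \<alpha>\<^esub> rep \<alpha> y"
  have "?b \<in> carrier (B \<alpha>)" "\<phi> \<alpha> ?b = x + scale c y"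
    using assms by (simp_all add: rep_carrier emb_rep emb_add emb_smult C.smult_carrier)
  then show ?thesis
    using rep_emb by metis
qed

text \<open>Connecting maps send positive elements to positive, hence self-adjoint, ones, so both
  sides agree there. Both sides are conjugate-linear in \<open>b\<close>, and
  \<open>pos_span_induct\<close> extends the equality to the whole algebra.\<close>

lemma emb_invol_rep:
  assumes "\<alpha> \<le> \<beta>" "b \<in> carrier (B \<alpha>)"
  shows "\<phi> \<beta> (invol (B \<beta>) (rep \<beta> (\<phi> \<alpha> b))) = \<phi> \<alpha> (invol (B \<alpha>) b)"
  using assms(2)
proof (induction rule: C.pos_span_induct)
  case (pos p)
  then have "rep \<beta> (\<phi> \<alpha> p) \<in> cstar_pos (B \<beta>)"
    using conn_pos assms(1) by (simp add: ind_conn_def)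
  moreover have "\<phi> \<alpha> p \<in> step \<beta>"
    using pos emb_step C.cstar_pos_carrier step_mono[OF assms(1)] by blast
  ultimately show ?case
    using pos by (simp add: C.invol_pos emb_rep)
next
  case (add y z)
  have "\<phi> \<alpha> y \<in> step \<beta>" "\<phi> \<alpha> z \<in> step \<beta>"
    using add emb_step step_mono[OF assms(1)] by blast+
  then show ?case
    using add rep_add_scale[of "\<phi> \<alpha> y" \<beta> "\<phi> \<alpha> z" 1]
    by (simp add: emb_add C.invol_add C.invol_closed rep_carrier C.one_smult)
next
  case (smult c y)
  have "\<phi> \<alpha> y \<in> step \<beta>"
    using smult emb_step step_mono[OF assms(1)] by blast
  then have "c \<odot>\<^bsub>B \<beta>\<^esub> rep \<beta> (\<phi> \<alpha> y) \<in> carrier (B \<beta>)"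
    "\<phi> \<beta> (c \<odot>\<^bsub>B \<beta>\<^esub> rep \<beta> (\<phi> \<alpha> y)) = scale c (\<phi> \<alpha> y)" "rep \<beta> (\<phi> \<alpha> y) \<in> carrier (B \<beta>)"
    by (simp_all add: rep_carrier C.smult_carrier emb_smult emb_rep)
  then have "rep \<beta> (scale c (\<phi> \<alpha> y)) = c \<odot>\<^bsub>B \<beta>\<^esub> rep \<beta> (\<phi> \<alpha> y)"
    using rep_emb by metis
  then show ?case
    using smult \<open>rep \<beta> (\<phi> \<alpha> y) \<in> carrier (B \<beta>)\<close>
    by (simp add: emb_smult C.invol_smult C.invol_closed)
qed

text \<open>Justifies the \<open>THE\<close> in \<open>ind_star\<close>: two indices are compared in
  a common upper bound through \<open>emb_invol_rep\<close>.\<close>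

lemma star_eq:
  assumes "x \<in> step \<alpha>"
  shows "star x = \<phi> \<alpha> (invol (B \<alpha>) (rep \<alpha> x))"
  unfolding ind_star_def
proof (rule the_equality)
  show "\<exists>\<beta>. x \<in> step \<beta> \<and> \<phi> \<alpha> (invol (B \<alpha>) (rep \<alpha> x)) = \<phi> \<beta> (invol (B \<beta>) (rep \<beta> x))"
    using assms by blast
next
  fix y assume "\<exists>\<beta>. x \<in> step \<beta> \<and> y = \<phi> \<beta> (invol (B \<beta>) (rep \<beta> x))"
  then obtain \<beta> where \<beta>: "x \<in> step \<beta>" "y = \<phi> \<beta> (invol (B \<beta>) (rep \<beta> x))"
    by blast
  obtain \<gamma> where "\<alpha> \<le> \<gamma>" "\<beta> \<le> \<gamma>"
    using directed by blast
  then show "y = \<phi> \<alpha> (invol (B \<alpha>) (rep \<alpha> x))"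
    using emb_invol_rep[of \<alpha> \<gamma> "rep \<alpha> x"] emb_invol_rep[of \<beta> \<gamma> "rep \<beta> x"] \<beta> assms
    by (simp add: rep_carrier emb_rep)
qed

lemma star_step: "x \<in> step \<alpha> \<Longrightarrow> star x \<in> step \<alpha>"
  by (simp add: star_eq emb_step C.invol_closed rep_carrier)

lemma rep_star: "x \<in> step \<alpha> \<Longrightarrow> rep \<alpha> (star x) = invol (B \<alpha>) (rep \<alpha> x)"
  by (simp add: star_eq rep_emb C.invol_closed rep_carrier)

text \<open>Expresses "from some index on" as a filter, so that finitely many thresholds merge
  without naming upper bounds.\<close>

definition tails :: "'i filter" where
  "tails = (INF \<gamma>. principal {\<gamma>..})"

lemma eventually_tails: "eventually P tails \<longleftrightarrow> (\<exists>\<gamma>. \<forall>\<beta>\<ge>\<gamma>. P \<beta>)"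
proof -
  have "\<exists>\<gamma>. {\<gamma>..} \<subseteq> {\<alpha>..} \<and> {\<gamma>..} \<subseteq> {\<beta>..}" for \<alpha> \<beta> :: 'i
    using directed[of \<alpha> \<beta>] by (auto intro: order_trans)
  then show ?thesis
    unfolding tails_def
    by (subst eventually_INF_base) (auto simp: eventually_principal)
qed

text \<open>The filter is proper, since each tail contains its starting index. In particular, a
  statement that does not mention the index and holds eventually is simply true.\<close>

lemma tails_obtain:
  assumes "eventually P tails"
  obtains \<beta> where "P \<beta>"
  using assms by (auto simp: eventually_tails)

lemma eventually_step: "\<forall>\<^sub>F \<beta> in tails. x \<in> step \<beta>"
  using step_exhaust step_mono by (fastforce simp: eventually_tails)

lemma ind_pos_iff:
  "x \<in> ind_pos B \<phi> \<longleftrightarrow> (\<forall>\<^sub>F \<beta> in tails. x \<in> step \<beta> \<and> rep \<beta> x \<in> cstar_pos (B \<beta>))"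
  by (simp add: ind_pos_def eventually_tails)

lemma emb_ind_pos:
  assumes "p \<in> cstar_pos (B \<alpha>)"
  shows "\<phi> \<alpha> p \<in> ind_pos B \<phi>"
proof -
  have "\<phi> \<alpha> p \<in> step \<beta> \<and> rep \<beta> (\<phi> \<alpha> p) \<in> cstar_pos (B \<beta>)" if "\<alpha> \<le> \<beta>" for \<beta>
    using conn_pos[OF that assms] emb_step[OF C.cstar_pos_carrier[OF assms]] step_mono[OF that]
    by (auto simp: ind_conn_def)
  then show ?thesis
    by (auto simp: ind_pos_def)
qed

lemma pos_functionals_linear:
  assumes "\<omega> \<in> pos_functionals scale B \<phi>"
  shows "\<omega> (x + y) = \<omega> x + \<omega> y" "\<omega> (scale c x) = c * \<omega> x"
proof -
  interpret Vector_Spaces.linear scale "(*)" \<omega>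
    using assms by (simp add: pos_functionals_def)
  show "\<omega> (x + y) = \<omega> x + \<omega> y" "\<omega> (scale c x) = c * \<omega> x"
    by (fact add scale)+
qed

lemma pos_functionals_pos:
  "\<lbrakk>\<omega> \<in> pos_functionals scale B \<phi>; x \<in> ind_pos B \<phi>\<rbrakk> \<Longrightarrow> 0 \<le> \<omega> x"
  by (simp add: pos_functionals_def)

text \<open>On positive elements the involution is trivial and \<open>\<omega>\<close> is real;
  \<open>pos_span_induct\<close> does the rest.\<close>

lemma pos_functionals_star:
  assumes \<omega>: "\<omega> \<in> pos_functionals scale B \<phi>"
  shows "\<omega> (star x) = cnj (\<omega> x)"
proof -
  obtain \<alpha> where \<alpha>: "x \<in> step \<alpha>"
    using eventually_step tails_obtain by blast
  have "\<omega> (\<phi> \<alpha> (invol (B \<alpha>) b)) = cnj (\<omega> (\<phi> \<alpha> b))" if "b \<in> carrier (B \<alpha>)" for b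
    using that
  proof (induction rule: C.pos_span_induct)
    case (pos p)
    then show ?case
      using pos_functionals_pos[OF \<omega> emb_ind_pos[OF pos]]
      by (simp add: C.invol_pos less_eq_complex_def complex_eq_iff)
  next
    case (add y z)
    then show ?case
      by (simp add: emb_add C.invol_add C.invol_closed pos_functionals_linear[OF \<omega>])
  next
    case (smult c y)
    then show ?case
      by (simp add: emb_smult C.invol_smult C.invol_closed pos_functionals_linear[OF \<omega>])
  qed
  from this[OF rep_carrier[OF \<alpha>]] show ?thesis
    using \<alpha> by (simp add: star_eq emb_rep)
qed

text \<open>From some index on, \<open>u\<close> is represented by the image of a unit, which is
  positive. This makes \<open>\<omega> (a* u a)\<close> real and nonnegative later.\<close>

lemma pre_unit_pos:
  assumes "pre_unit B \<phi> u"
  shows "u \<in> ind_pos B \<phi>"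
proof -
  obtain \<gamma> where \<gamma>: "\<forall>\<beta>\<ge>\<gamma>. rep \<beta> u = ind_conn B \<phi> \<beta> \<gamma> \<one>\<^bsub>B \<gamma>\<^esub>" and "\<forall>\<beta>. u \<in> step \<beta>"
    using assms by (auto simp: pre_unit_def)
  then show ?thesis
    using conn_pos C.one_pos by (auto simp: ind_pos_def intro!: exI[of _ \<gamma>])
qed

end

section \<open>The partial multiplication and its universal right multipliers\<close>

context cstar_inductive_partial_algebra
begin

interpretation C: cstar_algebra "B \<alpha>" for \<alpha>
  by (rule cstar)

abbreviation "RA \<equiv> right_mults B \<phi> w"
abbreviation "sw \<equiv> sandwich B \<phi> w"

lemma w_carrier: "w \<beta> \<in> carrier (B \<beta>)" and invol_w: "invol (B \<beta>) (w \<beta>) = w \<beta>"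
  using C.cstar_posD w_pos by blast+

text \<open>Replaces the threshold and the \<open>THE\<close> of the partial product by one eventual
  equation; the value is unique because the filter is proper. \<open>eventually_pmult\<close> is the
  way back.\<close>

lemma pmult_eqI:
  assumes "\<forall>\<^sub>F \<beta> in tails. step_mult B \<phi> w \<beta> x y = z"
  shows "pmult_defined B \<phi> w x y" and "pmult B \<phi> w x y = z"
proof -
  have "\<forall>\<^sub>F \<beta> in tails. x \<in> step \<beta> \<and> y \<in> step \<beta> \<and> step_mult B \<phi> w \<beta> x y = z"
    using assms eventually_step[of x] eventually_step[of y] by eventually_elim simp
  then obtain \<gamma> where
    \<gamma>: "\<forall>\<beta>\<ge>\<gamma>. x \<in> step \<beta> \<and> y \<in> step \<beta> \<and> step_mult B \<phi> w \<beta> x y = z"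
    by (auto simp: eventually_tails)
  then show "pmult_defined B \<phi> w x y"
    unfolding pmult_defined_def by (intro exI[of _ \<gamma>]) auto
  show "pmult B \<phi> w x y = z"
    unfolding pmult_def
  proof (rule the_equality)
    show "\<exists>\<gamma>. x \<in> step \<gamma> \<and> y \<in> step \<gamma> \<and> (\<forall>\<beta>\<ge>\<gamma>. z = step_mult B \<phi> w \<beta> x y)"
      using \<gamma> by (intro exI[of _ \<gamma>]) auto
  next
    fix z' assume "\<exists>\<gamma>. x \<in> step \<gamma> \<and> y \<in> step \<gamma> \<and> (\<forall>\<beta>\<ge>\<gamma>. z' = step_mult B \<phi> w \<beta> x y)"
    then have "\<forall>\<^sub>F \<beta> in tails. z' = step_mult B \<phi> w \<beta> x y"
      by (auto simp: eventually_tails)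
    with assms have "\<forall>\<^sub>F \<beta> in tails. z' = z"
      by eventually_elim simp
    then show "z' = z"
      by (auto elim: tails_obtain)
  qed
qed

lemma eventually_pmult:
  assumes "pmult_defined B \<phi> w x y"
  shows "\<forall>\<^sub>F \<beta> in tails. step_mult B \<phi> w \<beta> x y = pmult B \<phi> w x y"
proof -
  obtain \<gamma> where
    "\<forall>\<beta>\<ge>\<gamma>. \<forall>\<beta>'\<ge>\<gamma>. step_mult B \<phi> w \<beta> x y = step_mult B \<phi> w \<beta>' x y"
    using assms by (auto simp: pmult_defined_def)
  then have "\<forall>\<^sub>F \<beta> in tails. step_mult B \<phi> w \<beta> x y = step_mult B \<phi> w \<gamma> x y"
    by (auto simp: eventually_tails intro!: exI[of _ \<gamma>])
  then show ?thesis
    using pmult_eqI(2) by metis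
qed

text \<open>Needed to test the form at \<open>a + c b\<close> in the Cauchy-Schwarz
  argument.\<close>

lemma right_mults_add_scale:
  assumes "a \<in> RA" "b \<in> RA"
  shows "a + scale c b \<in> RA"
proof -
  have "pmult_defined B \<phi> w y (a + scale c b)" for y
  proof (rule pmult_eqI(1))
    have "\<forall>\<^sub>F \<beta> in tails. step_mult B \<phi> w \<beta> y a = pmult B \<phi> w y a"
      "\<forall>\<^sub>F \<beta> in tails. step_mult B \<phi> w \<beta> y b = pmult B \<phi> w y b"
      using assms eventually_pmult by (auto simp: right_mults_def)
    with eventually_step[of y] eventually_step[of a] eventually_step[of b]
    show "\<forall>\<^sub>F \<beta> in tails. step_mult B \<phi> w \<beta> y (a + scale c b) =
        pmult B \<phi> w y a + scale c (pmult B \<phi> w y b)"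
    proof eventually_elim
      case (elim \<beta>)
      then show ?case
        by (simp add: step_mult_def rep_add_scale rep_carrier w_carrier C.smult_carrier
            C.distribs C.smult_mult_right emb_add emb_smult flip: elim(4,5))
    qed
  qed
  then show ?thesis
    by (simp add: right_mults_def)
qed

text \<open>Since \<open>w\<close> is self-adjoint, the product of \<open>a*\<close> and
  \<open>y\<close> is the adjoint of the product of \<open>y*\<close> and \<open>a\<close>, which
  exists for a right multiplier \<open>a\<close>.\<close>

lemma right_mults_star:
  assumes "a \<in> RA"
  shows "pmult_defined B \<phi> w (star a) y"
proof (rule pmult_eqI(1))
  have "\<forall>\<^sub>F \<beta> in tails. step_mult B \<phi> w \<beta> (star y) a = pmult B \<phi> w (star y) a"
    using assms eventually_pmult by (auto simp: right_mults_def)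
  with eventually_step[of a] eventually_step[of y]
  show "\<forall>\<^sub>F \<beta> in tails. step_mult B \<phi> w \<beta> (star a) y = star (pmult B \<phi> w (star y) a)"
  proof eventually_elim
    case (elim \<beta>)
    let ?b = "invol (B \<beta>) (rep \<beta> y) \<otimes>\<^bsub>B \<beta>\<^esub> w \<beta> \<otimes>\<^bsub>B \<beta>\<^esub> rep \<beta> a"
    have b: "?b \<in> carrier (B \<beta>)"
      using elim by (simp add: rep_carrier w_carrier C.invol_closed)
    have "star (pmult B \<phi> w (star y) a) = \<phi> \<beta> (invol (B \<beta>) ?b)"
      using elim b star_eq[OF emb_step[OF b]]
      by (simp add: step_mult_def rep_star rep_emb flip: elim(3))
    also have "\<dots> = step_mult B \<phi> w \<beta> (star a) y"
      using elim
      by (simp add: step_mult_def rep_star rep_carrier w_carrier C.invol_closed C.invol_mult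
          C.invol_invol invol_w C.mult_assoc)
    finally show ?case ..
  qed
qed

section \<open>The products \<open>b* y a\<close>\<close>

text \<open>The transfer principle: at every large index \<open>b* y a\<close> is computed in one
  algebra, so identities and positivity reduce to the triple products there.\<close>

lemma eventually_sandwich:
  assumes "a \<in> RA" "b \<in> RA"
  shows "\<forall>\<^sub>F \<beta> in tails. y \<in> step \<beta> \<and> a \<in> step \<beta> \<and> b \<in> step \<beta> \<and>
    sw b y a = \<phi> \<beta> (invol (B \<beta>) (rep \<beta> b) \<otimes>\<^bsub>B \<beta>\<^esub> w \<beta> \<otimes>\<^bsub>B \<beta>\<^esub>
      (rep \<beta> y \<otimes>\<^bsub>B \<beta>\<^esub> w \<beta> \<otimes>\<^bsub>B \<beta>\<^esub> rep \<beta> a))"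
proof -
  have "\<forall>\<^sub>F \<beta> in tails. step_mult B \<phi> w \<beta> y a = pmult B \<phi> w y a"
    using assms eventually_pmult by (auto simp: right_mults_def)
  moreover have "\<forall>\<^sub>F \<beta> in tails. step_mult B \<phi> w \<beta> (star b) (pmult B \<phi> w y a) = sw b y a"
    unfolding sandwich_def using right_mults_star[OF assms(2)] by (rule eventually_pmult)
  ultimately show ?thesis
    using eventually_step[of y] eventually_step[of a] eventually_step[of b]
  proof eventually_elim
    case (elim \<beta>)
    \<comment> \<open>Both partial products are read at the same index, where the inner one is the
      embedded algebra product.\<close>
    have "rep \<beta> (pmult B \<phi> w y a) = rep \<beta> y \<otimes>\<^bsub>B \<beta>\<^esub> w \<beta> \<otimes>\<^bsub>B \<beta>\<^esub> rep \<beta> a"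
      using elim by (simp add: step_mult_def rep_emb rep_carrier w_carrier flip: elim(1))
    then show ?case
      using elim(3-5) by (simp add: step_mult_def rep_star flip: elim(2))
  qed
qed

lemma sandwich_diagonal:
  assumes "a \<in> RA" "b \<in> RA"
  shows "sw (a + scale c b) p (a + scale c b) =
    sw a p a + scale c (sw a p b) + scale (cnj c) (sw b p a) + scale (c * cnj c) (sw b p b)"
proof -
  note ab = right_mults_add_scale[OF assms, of c]
  have "\<forall>\<^sub>F \<beta> in tails. ?thesis"
    using eventually_sandwich[OF ab ab, of p] eventually_sandwich[OF assms(1,1), of p]
      eventually_sandwich[OF assms(2,1), of p] eventually_sandwich[OF assms(1,2), of p]
      eventually_sandwich[OF assms(2,2), of p]
  proof eventually_elim
    case (elim \<beta>)
    then show ?case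
      by (simp add: rep_add_scale C.triple_diagonal rep_carrier w_carrier C.invol_closed
          C.smult_carrier emb_add emb_smult)
  qed
  then show ?thesis
    by (auto elim: tails_obtain)
qed

lemma sandwich_middle:
  assumes "a \<in> RA" "b \<in> RA"
  shows "sw b (y + scale c z) a = sw b y a + scale c (sw b z a)"
proof -
  have "\<forall>\<^sub>F \<beta> in tails. ?thesis"
    using eventually_sandwich[OF assms, of y] eventually_sandwich[OF assms, of z]
      eventually_sandwich[OF assms, of "y + scale c z"]
  proof eventually_elim
    case (elim \<beta>)
    then show ?case
      by (simp add: rep_add_scale C.triple_middle rep_carrier w_carrier C.invol_closed
          C.smult_carrier emb_add emb_smult)
  qed
  then show ?thesis
    by (auto elim: tails_obtain)
qed

lemma star_sandwich:
  assumes "a \<in> RA" "b \<in> RA"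
  shows "star (sw b y a) = sw a (star y) b"
proof -
  have "\<forall>\<^sub>F \<beta> in tails. ?thesis"
    using eventually_sandwich[OF assms, of y] eventually_sandwich[OF assms(2,1), of "star y"]
  proof eventually_elim
    case (elim \<beta>)
    then show ?case
      by (subst star_eq[of _ \<beta>])
        (simp_all add: emb_step rep_emb rep_star C.triple_invol rep_carrier w_carrier invol_w
          C.invol_closed)
  qed
  then show ?thesis
    by (auto elim: tails_obtain)
qed

lemma sandwich_pos:
  assumes "p \<in> ind_pos B \<phi>" "a \<in> RA"
  shows "sw a p a \<in> ind_pos B \<phi>"
  unfolding ind_pos_iff
  using eventually_sandwich[OF assms(2,2), of p] assms(1)[unfolded ind_pos_iff]
proof eventually_elim
  case (elim \<beta>)
  then show ?case
    using C.triple_pos[of "rep \<beta> a" \<beta> "rep \<beta> p" "w \<beta>"]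
    by (simp add: emb_step rep_emb rep_carrier w_carrier invol_w C.invol_closed)
qed

section \<open>Cauchy-Schwarz and the estimates that follow from order bounds\<close>

lemma sandwich_cauchy_schwarz:
  assumes \<omega>: "\<omega> \<in> pos_functionals scale B \<phi>" and p: "p \<in> ind_pos B \<phi>"
    and a: "a \<in> RA" and b: "b \<in> RA"
  shows "(cmod (\<omega> (sw b p a)))\<^sup>2 \<le> Re (\<omega> (sw a p a)) * Re (\<omega> (sw b p b))"
proof (rule sesquilinear_discriminant)
  fix c
  have "0 \<le> \<omega> (sw (a + scale c b) p (a + scale c b))"
    using a b by (intro pos_functionals_pos[OF \<omega>] sandwich_pos p right_mults_add_scale)
  then show "0 \<le> \<omega> (sw a p a) + c * \<omega> (sw a p b) + cnj c * \<omega> (sw b p a)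
      + c * cnj c * \<omega> (sw b p b)"
    by (simp add: sandwich_diagonal a b pos_functionals_linear[OF \<omega>])
next
  show "0 \<le> \<omega> (sw b p b)"
    by (intro pos_functionals_pos[OF \<omega>] sandwich_pos p b)
qed

lemma functional_sandwich_linear:
  assumes \<omega>: "\<omega> \<in> pos_functionals scale B \<phi>" and "a \<in> RA" "b \<in> RA"
  shows "\<omega> (sw b (y + z) a) = \<omega> (sw b y a) + \<omega> (sw b z a)"
    and "\<omega> (sw b (y - z) a) = \<omega> (sw b y a) - \<omega> (sw b z a)"
    and "\<omega> (sw b (- z) a) = - \<omega> (sw b z a)"
    and "\<omega> (sw b (scale c z) a) = c * \<omega> (sw b z a)"
proof -
  have *: "\<omega> (sw b (y + scale c z) a) = \<omega> (sw b y a) + c * \<omega> (sw b z a)" for y z c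
    by (simp add: sandwich_middle assms(2,3) pos_functionals_linear[OF \<omega>])
  \<comment> \<open>With all arguments zero, \<open>*\<close> reads
    \<open>X = X + X\<close>.\<close>
  have 0: "\<omega> (sw b 0 a) = 0"
    using *[of 0 1 0] by simp
  show "\<omega> (sw b (y + z) a) = \<omega> (sw b y a) + \<omega> (sw b z a)"
    using *[of y 1 z] by simp
  show "\<omega> (sw b (y - z) a) = \<omega> (sw b y a) - \<omega> (sw b z a)"
    using *[of y "-1" z] by simp
  show "\<omega> (sw b (- z) a) = - \<omega> (sw b z a)"
    using *[of 0 "-1" z] 0 by simp
  show "\<omega> (sw b (scale c z) a) = c * \<omega> (sw b z a)"
    using *[of 0 c z] 0 by simp
qed

lemma order_interval_bound:
  assumes \<omega>: "\<omega> \<in> pos_functionals scale B \<phi>" and a: "a \<in> RA" and b: "b \<in> RA"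
    and le: "ind_le B \<phi> (- scale (of_real r) u) y" "ind_le B \<phi> y (scale (of_real r) u)"
  shows "(cmod (\<omega> (sw b y a)))\<^sup>2 \<le> r\<^sup>2 * (Re (\<omega> (sw a u a)) * Re (\<omega> (sw b u b)))"
proof -
  \<comment> \<open>The two order bounds say that \<open>p\<close> and \<open>q\<close> are
    positive; moreover \<open>p + q = 2 r u\<close> and \<open>p - q = 2 y\<close>.\<close>
  define p q where "p = y - - scale (of_real r) u" and "q = scale (of_real r) u - y"
  have pq: "p \<in> ind_pos B \<phi>" "q \<in> ind_pos B \<phi>"
    using le by (simp_all add: ind_le_def p_def q_def)
  note lin = functional_sandwich_linear[OF \<omega>]
  let ?F = "\<lambda>v. cmod (\<omega> (sw b v a))"
  let ?A = "\<lambda>v. Re (\<omega> (sw a v a))"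
  let ?B = "\<lambda>v. Re (\<omega> (sw b v b))"
  have nonneg: "0 \<le> ?A v" "0 \<le> ?B v" if "v \<in> ind_pos B \<phi>" for v
    using that a b sandwich_pos pos_functionals_pos[OF \<omega>] by (auto simp: less_eq_complex_def)
  have cs: "(?F v)\<^sup>2 \<le> ?A v * ?B v" if "v \<in> ind_pos B \<phi>" for v
    using that a b \<omega> sandwich_cauchy_schwarz by blast
  have "2 * \<omega> (sw b y a) = \<omega> (sw b p a) - \<omega> (sw b q a)"
    by (simp add: p_def q_def lin a b)
  then have "2 * ?F y \<le> ?F p + ?F q"
    using norm_triangle_ineq4[of "\<omega> (sw b p a)" "\<omega> (sw b q a)"]
    by (metis norm_mult norm_numeral)
  then have "(2 * ?F y)\<^sup>2 \<le> (?F p + ?F q)\<^sup>2"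
    by (intro power_mono) auto
  also have "\<dots> \<le> (?A p + ?A q) * (?B p + ?B q)"
    using cs pq nonneg by (intro square_sum_le_product) auto
  \<comment> \<open>Each factor contributes \<open>2 r\<close>; the resulting \<open>4\<close>
    cancels against the square of \<open>2 * ?F y\<close>.\<close>
  also have "?A p + ?A q = 2 * r * ?A u"
    by (simp add: p_def q_def lin a)
  also have "?B p + ?B q = 2 * r * ?B u"
    by (simp add: p_def q_def lin b)
  finally show ?thesis
    by (simp add: power2_eq_square algebra_simps)
qed

lemma order_bounded_imp_bound:
  assumes "order_bounded scale B \<phi> u x"
  obtains K :: real where "0 < K"
    "\<And>\<omega> a b. \<lbrakk>\<omega> \<in> pos_functionals scale B \<phi>; a \<in> RA; b \<in> RA\<rbrakk> \<Longrightarrow>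
      (cmod (\<omega> (sw b x a)))\<^sup>2 \<le> K * (Re (\<omega> (sw a u a)) * Re (\<omega> (sw b u b)))"
proof -
  let ?R = "ind_Re scale B \<phi> x" and ?I = "ind_Im scale B \<phi> x"
  obtain r :: real where r: "0 < r"
    "ind_le B \<phi> (- scale (of_real r) u) ?R" "ind_le B \<phi> ?R (scale (of_real r) u)"
    "ind_le B \<phi> (- scale (of_real r) u) ?I" "ind_le B \<phi> ?I (scale (of_real r) u)"
    using assms by (auto simp: order_bounded_def)
  show thesis
  proof
    \<comment> \<open>The \<open>4\<close> is \<open>2 + 2\<close> from
      \<open>(m + n)\<^sup>2 \<le> 2 m\<^sup>2 + 2 n\<^sup>2\<close>, where each square is bounded
      with the constant \<open>r\<^sup>2\<close>.\<close>
    show "0 < 4 * r\<^sup>2"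
      using r by simp
    fix \<omega> a b
    assume *: "\<omega> \<in> pos_functionals scale B \<phi>" "a \<in> RA" "b \<in> RA"
    let ?F = "\<lambda>v. \<omega> (sw b v a)"
    note lin = functional_sandwich_linear[OF *]
    have "?F x = ?F ?R + \<i> * ?F ?I"
      by (simp add: ind_Re_def ind_Im_def lin field_simps)
    then have "cmod (?F x) \<le> cmod (?F ?R) + cmod (?F ?I)"
      using norm_triangle_ineq[of "?F ?R" "\<i> * ?F ?I"] by (simp add: norm_mult)
    then have "(cmod (?F x))\<^sup>2 \<le> (cmod (?F ?R) + cmod (?F ?I))\<^sup>2"
      by (intro power_mono) auto
    also have "\<dots> \<le> 2 * (cmod (?F ?R))\<^sup>2 + 2 * (cmod (?F ?I))\<^sup>2"
      using zero_le_power2[of "cmod (?F ?R) - cmod (?F ?I)"]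
      by (simp add: power2_eq_square algebra_simps)
    finally show "(cmod (?F x))\<^sup>2 \<le> 4 * r\<^sup>2 * (Re (\<omega> (sw a u a)) * Re (\<omega> (sw b u b)))"
      using order_interval_bound[OF * r(2,3)] order_interval_bound[OF * r(4,5)] by linarith
  qed
qed

section \<open>From bounds on functionals back to the order\<close>

text \<open>The star moves inside the product and \<open>\<omega>\<close> is hermitian, so replacing
  \<open>x\<close> by \<open>x*\<close> conjugates the value.\<close>

lemma functional_sandwich_Re_Im:
  assumes \<omega>: "\<omega> \<in> pos_functionals scale B \<phi>" and a: "a \<in> RA"
  shows "\<omega> (sw a (ind_Re scale B \<phi> x) a) = of_real (Re (\<omega> (sw a x a)))"
    and "\<omega> (sw a (ind_Im scale B \<phi> x) a) = of_real (Im (\<omega> (sw a x a)))"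
proof -
  have "\<omega> (sw a (star x) a) = cnj (\<omega> (sw a x a))"
    using star_sandwich[OF a a, of x] pos_functionals_star[OF \<omega>] by metis
  then show "\<omega> (sw a (ind_Re scale B \<phi> x) a) = of_real (Re (\<omega> (sw a x a)))"
    "\<omega> (sw a (ind_Im scale B \<phi> x) a) = of_real (Im (\<omega> (sw a x a)))"
    by (simp_all add: ind_Re_def ind_Im_def functional_sandwich_linear[OF \<omega> a a]
        complex_eq_iff Re_divide Im_divide)
qed

text \<open>\<open>K\<close> itself serves as the order bound: for \<open>y\<close> the real or
  imaginary part of \<open>x\<close>, the elements \<open>K u + y\<close> and \<open>K u - y\<close>
  pass the test in \<open>detect\<close>.\<close>

lemma bound_imp_order_bounded:
  assumes detect: "\<And>y. (\<forall>\<omega>\<in>pos_functionals scale B \<phi>. \<forall>a\<in>RA. 0 \<le> \<omega> (sw a y a))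
      \<Longrightarrow> y \<in> ind_pos B \<phi>"
    and "0 < K"
    and bound: "\<And>\<omega> a. \<lbrakk>\<omega> \<in> pos_functionals scale B \<phi>; a \<in> RA\<rbrakk> \<Longrightarrow>
      of_real (cmod (\<omega> (sw a x a))) \<le> of_real K * \<omega> (sw a u a)"
  shows "order_bounded scale B \<phi> u x"
proof -
  \<comment> \<open>Treats both parts of \<open>x\<close> at once: all that matters is that the
    values of \<open>y\<close> are real and dominated by those of \<open>x\<close>.\<close>
  have le: "ind_le B \<phi> (- scale (of_real K) u) y \<and> ind_le B \<phi> y (scale (of_real K) u)"
    if y: "\<And>\<omega> a. \<lbrakk>\<omega> \<in> pos_functionals scale B \<phi>; a \<in> RA\<rbrakk> \<Longrightarrow>
      \<exists>t. \<omega> (sw a y a) = of_real t \<and> \<bar>t\<bar> \<le> cmod (\<omega> (sw a x a))" for y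
    unfolding ind_le_def
  proof (intro conjI detect ballI)
    fix \<omega> a assume *: "\<omega> \<in> pos_functionals scale B \<phi>" "a \<in> RA"
    obtain t where t: "\<omega> (sw a y a) = of_real t" "\<bar>t\<bar> \<le> cmod (\<omega> (sw a x a))"
      using y[OF *] by blast
    then show "0 \<le> \<omega> (sw a (y - - scale (of_real K) u) a)"
      "0 \<le> \<omega> (sw a (scale (of_real K) u - y) a)"
      using bound[OF *]
      by (auto simp: functional_sandwich_linear[OF *(1,2,2)] less_eq_complex_def)
  qed
  show ?thesis
    unfolding order_bounded_def
    using \<open>0 < K\<close> le[of "ind_Re scale B \<phi> x"] le[of "ind_Im scale B \<phi> x"]
      functional_sandwich_Re_Im abs_Re_le_cmod abs_Im_le_cmod
    by blast
qed

end

theorem theorem5p4: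
  fixes scale :: "complex \<Rightarrow> 'a::ab_group_add \<Rightarrow> 'a"
    and B :: "'i::preorder \<Rightarrow> 'b cstar"
    and \<phi> :: "'i \<Rightarrow> 'b \<Rightarrow> 'a"
    and w :: "'i \<Rightarrow> 'b"
    and u x :: 'a
  assumes "cstar_inductive_partial_algebra scale B \<phi> w"
    and "pre_unit B \<phi> u"
    and "\<And>y. (\<forall>\<omega>\<in>pos_functionals scale B \<phi>. \<forall>a\<in>right_mults B \<phi> w.
               0 \<le> \<omega> (sandwich B \<phi> w a y a)) \<Longrightarrow> y \<in> ind_pos B \<phi>"
  shows
    "(order_bounded scale B \<phi> u x \<longleftrightarrow>
       (\<exists>\<gamma>::real. 0 < \<gamma> \<and>
         (\<forall>\<omega>\<in>pos_functionals scale B \<phi>. \<forall>a\<in>right_mults B \<phi> w.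
           complex_of_real (cmod (\<omega> (sandwich B \<phi> w a x a)))
             \<le> complex_of_real \<gamma> * \<omega> (sandwich B \<phi> w a u a)))) \<and>
     (order_bounded scale B \<phi> u x \<longleftrightarrow>
       (\<exists>\<gamma>::real. 0 < \<gamma> \<and>
         (\<forall>\<omega>\<in>pos_functionals scale B \<phi>.
           \<forall>a\<in>right_mults B \<phi> w. \<forall>b\<in>right_mults B \<phi> w.
             complex_of_real ((cmod (\<omega> (sandwich B \<phi> w b x a)))\<^sup>2)
               \<le> complex_of_real \<gamma> * \<omega> (sandwich B \<phi> w a u a)
                   * \<omega> (sandwich B \<phi> w b u b))))"
proof -
  interpret cstar_inductive_partial_algebra scale B \<phi> w
    by (rule assms(1))
  let ?P = "pos_functionals scale B \<phi>"
  \<comment> \<open>Allows the complex inequalities in (ii) and (iii) to be handled as real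
    ones.\<close>
  have u: "\<omega> (sw a u a) = of_real (Re (\<omega> (sw a u a)))" "0 \<le> Re (\<omega> (sw a u a))"
    if "\<omega> \<in> ?P" "a \<in> RA" for \<omega> a
    using pos_functionals_pos[OF that(1) sandwich_pos[OF pre_unit_pos[OF assms(2)] that(2)]]
    by (auto simp: less_eq_complex_def complex_eq_iff)
  let ?i = "order_bounded scale B \<phi> u x"
  let ?ii = "\<exists>\<gamma>::real. 0 < \<gamma> \<and> (\<forall>\<omega>\<in>?P. \<forall>a\<in>RA.
    complex_of_real (cmod (\<omega> (sw a x a))) \<le> complex_of_real \<gamma> * \<omega> (sw a u a))"
  let ?iii = "\<exists>\<gamma>::real. 0 < \<gamma> \<and> (\<forall>\<omega>\<in>?P. \<forall>a\<in>RA. \<forall>b\<in>RA.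
    complex_of_real ((cmod (\<omega> (sw b x a)))\<^sup>2)
      \<le> complex_of_real \<gamma> * \<omega> (sw a u a) * \<omega> (sw b u b))"
  \<comment> \<open>The cycle (i), (iii), (ii), (i) yields both equivalences.\<close>
  have "?iii" if i: ?i
  proof -
    obtain K where K: "0 < K" "\<And>\<omega> a b. \<lbrakk>\<omega> \<in> ?P; a \<in> RA; b \<in> RA\<rbrakk> \<Longrightarrow>
      (cmod (\<omega> (sw b x a)))\<^sup>2 \<le> K * (Re (\<omega> (sw a u a)) * Re (\<omega> (sw b u b)))"
      using order_bounded_imp_bound[OF i] by blast
    have "complex_of_real ((cmod (\<omega> (sw b x a)))\<^sup>2)
        \<le> complex_of_real K * \<omega> (sw a u a) * \<omega> (sw b u b)"
      if *: "\<omega> \<in> ?P" "a \<in> RA" "b \<in> RA" for \<omega> a b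
    proof -
      obtain s t where "\<omega> (sw a u a) = of_real s" "\<omega> (sw b u b) = of_real t"
        using u(1) * by blast
      then show ?thesis
        using K(2)[OF *] by (simp add: less_eq_complex_def mult.assoc)
    qed
    then show ?thesis
      using K(1) by blast
  qed
  moreover have "?ii" if iii: ?iii
  proof -
    obtain K :: real where K: "0 < K" "\<And>\<omega> a b. \<lbrakk>\<omega> \<in> ?P; a \<in> RA; b \<in> RA\<rbrakk> \<Longrightarrow>
      complex_of_real ((cmod (\<omega> (sw b x a)))\<^sup>2)
        \<le> complex_of_real K * \<omega> (sw a u a) * \<omega> (sw b u b)"
      using iii by blast
    \<comment> \<open>For \<open>b = a\<close> the bound in (iii) is the square of
      \<open>sqrt K * \<omega> (a* u a)\<close>; the root may be taken because this number is
      nonnegative.\<close>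
    have "complex_of_real (cmod (\<omega> (sw a x a))) \<le> complex_of_real (sqrt K) * \<omega> (sw a u a)"
      if "\<omega> \<in> ?P" "a \<in> RA" for \<omega> a
    proof -
      define t where "t = Re (\<omega> (sw a u a))"
      have t: "\<omega> (sw a u a) = of_real t" "0 \<le> t"
        using u[OF that] by (simp_all add: t_def)
      have "(cmod (\<omega> (sw a x a)))\<^sup>2 \<le> K * t * t"
        using K(2)[OF that that(2)] t by (simp add: less_eq_complex_def)
      also have "\<dots> = (sqrt K * t)\<^sup>2"
        using K(1) by (simp add: power_mult_distrib power2_eq_square)
      finally have "cmod (\<omega> (sw a x a)) \<le> sqrt K * t"
        by (rule power2_le_imp_le) (use K(1) t(2) in simp)
      then show ?thesis
        by (simp add: t less_eq_complex_def)
    qed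
    then show ?thesis
      using K(1) by (intro exI[of _ "sqrt K"]) auto
  qed
  moreover have "?i" if ?ii
    using that bound_imp_order_bounded[OF assms(3)] by blast
  ultimately show ?thesis
    by blast
qed

end
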